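(* Let $\theta(z) = \int_2^\infty \frac{\pi(t) - Li(t)}{t^{z+1}}\,dt$, which is a holomorphic function on $\{z \in \mathbb{C} : \operatorname{Re} z > 1\}$. Let $G \subset \{z \in \mathbb{C} : \operatorname{Re} z > \tfrac{1}{2}\}$ be a simply connected domain with $G \cap \{\operatorname{Re} z > 1\} \neq \emptyset$, and suppose that $\theta$ extends holomorphically to $G$, i.e. there is a holomorphic function $\Theta$ on $G$ with $\Theta = \theta$ on $G \cap \{\operatorname{Re} z > 1\}$. Then the Riemann zeta function $\varsigma$ has no zeros in $G$, i.e. $\varsigma(z) \neq 0$ for all $z \in G$ (where, if $1 \in G$, the point $z = 1$ is the pole of $\varsigma$ and is not a zero).
   Context: Here $\pi(t)$ is the number of prime numbers in the segment $[2,t]$, and $Li(t) = \int_2^t \frac{ds}{\ln s}$. The function $\varsigma$ is the Riemann zeta function: $\varsigma(z) = \sum_{k=1}^\infty k^{-z}$ for $\operatorname{Re} z > 1$, extended holomorphically to $\mathbb{C} \setminus \{1\}$, with a simple pole at $z = 1$. A domain is a nonempty connected open subset of $\mathbb{C}$. *)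

theory Defs
  imports
    "HOL-Complex_Analysis.Complex_Analysis"
    "HOL-Computational_Algebra.Primes"
begin

definition prime_pi :: "real \<Rightarrow> nat" where
  "prime_pi t = card {p::nat. prime p \<and> real p \<le> t}"

definition Li :: "real \<Rightarrow> real" where
  "Li t = (LBINT s:{2..t}. 1 / ln s)"

definition theta :: "complex \<Rightarrow> complex" where
  "theta z = (LBINT t:{2..}. complex_of_real (real (prime_pi t) - Li t) / of_real t powr (z + 1))"

definition is_zeta_continuation :: "(complex \<Rightarrow> complex) \<Rightarrow> bool" where
  "is_zeta_continuation f \<longleftrightarrow>
     f holomorphic_on - {1} \<and>
     (\<forall>z. Re z > 1 \<longrightarrow> (\<lambda>k. of_nat (Suc k) powr (- z)) sums f z)"

(* The value at the pole 1 is arbitrary; existence and uniqueness away from 1 are proved below. *)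
definition riemann_zeta :: "complex \<Rightarrow> complex" where
  "riemann_zeta = (SOME f. is_zeta_continuation f)"

subsection \<open>Existence and uniqueness of the continuation\<close>

lemma holomorphic_suminf_local_bound:
  fixes f :: "nat \<Rightarrow> complex \<Rightarrow> complex"
  assumes S: "open S" and hol: "\<And>n. f n holomorphic_on S"
    and bd: "\<And>x. x \<in> S \<Longrightarrow> \<exists>d M. 0 < d \<and> cball x d \<subseteq> S \<and> summable M \<and> (\<forall>n. \<forall>y\<in>cball x d. norm (f n y) \<le> M n)"
  shows "(\<lambda>z. \<Sum>n. f n z) holomorphic_on S"
proof (rule holomorphic_uniform_sequence[OF S, where f = "\<lambda>n z. \<Sum>i<n. f i z"])
  show "(\<lambda>z. \<Sum>i<n. f i z) holomorphic_on S" for n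
    by (intro holomorphic_on_sum hol)
  fix x assume "x \<in> S"
  then obtain d M where dM: "0 < d" "cball x d \<subseteq> S" "summable M" "\<forall>n. \<forall>y\<in>cball x d. norm (f n y) \<le> M n"
    using bd[OF \<open>x \<in> S\<close>] by (elim exE conjE)
  show "\<exists>d>0. cball x d \<subseteq> S \<and> uniform_limit (cball x d) (\<lambda>n z. \<Sum>i<n. f i z) (\<lambda>z. \<Sum>n. f n z) sequentially"
  proof (intro exI[of _ d] conjI dM(1,2))
    show "uniform_limit (cball x d) (\<lambda>n z. \<Sum>i<n. f i z) (\<lambda>z. \<Sum>n. f n z) sequentially"
      by (rule Weierstrass_m_test[OF _ dM(3)]) (use dM(4) in blast)
  qed
qed

(* Taylor remainder of (1 + x) powr w at x = 0 *)
definition binom_rem :: "nat \<Rightarrow> complex \<Rightarrow> real \<Rightarrow> complex" where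
  "binom_rem K w x = (1 + of_real x) powr w - (\<Sum>k<K. (w gchoose k) * of_real x ^ k)"

lemma binom_rem_deriv:
  assumes "0 \<le> x"
  shows "(binom_rem (Suc K) w has_vector_derivative w * binom_rem K (w - 1) x) (at x within A)"
proof -
  have nr: "1 + complex_of_real x \<notin> \<real>\<^sub>\<le>\<^sub>0"
    using assms by (auto simp: complex_nonpos_Reals_iff)
  have "((\<lambda>y. (1 + y) powr w - (\<Sum>k<Suc K. (w gchoose k) * y ^ k)) has_field_derivative
      w * (1 + of_real x) powr (w - 1) - (\<Sum>k<Suc K. (w gchoose k) * (of_nat k * of_real x ^ (k - 1)))) (at (of_real x))"
    using nr by (auto intro!: derivative_eq_intros sum.cong)
  also have "(\<Sum>k<Suc K. (w gchoose k) * (of_nat k * complex_of_real x ^ (k - 1))) =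
     (\<Sum>k<K. (w gchoose Suc k) * (of_nat (Suc k) * of_real x ^ k))"
    by (subst sum.lessThan_Suc_shift) simp
  also have "\<dots> = w * (\<Sum>k<K. (w - 1 gchoose k) * of_real x ^ k)"
  proof -
    have "(w gchoose Suc k) * (of_nat (Suc k) * complex_of_real x ^ k) = w * ((w - 1 gchoose k) * of_real x ^ k)" for k
      using gbinomial_absorption[of k w] by (metis mult.assoc mult.commute)
    then show ?thesis by (simp only: sum_distrib_left)
  qed
  finally have "((\<lambda>y. (1 + y) powr w - (\<Sum>k<Suc K. (w gchoose k) * y ^ k)) has_field_derivative
      w * binom_rem K (w - 1) x) (at (of_real x))"
    by (simp add: binom_rem_def algebra_simps)
  from has_vector_derivative_real_field[OF this] show ?thesis
    by (simp add: binom_rem_def[abs_def])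
qed

lemma binom_rem_bound:
  "\<exists>C\<ge>0. \<forall>w x. norm w \<le> r \<longrightarrow> 0 \<le> x \<longrightarrow> x \<le> 1 \<longrightarrow> norm (binom_rem K w x) \<le> C * x ^ K"
proof (induction K arbitrary: r)
  case 0
  have "norm (binom_rem 0 w x) \<le> 2 powr \<bar>r\<bar>" if "norm w \<le> r" "0 \<le> x" "x \<le> 1" for w x
  proof -
    have "norm (binom_rem 0 w x) = norm (complex_of_real (1 + x) powr w)"
      by (simp add: binom_rem_def)
    also have "\<dots> = (1 + x) powr Re w"
      by (subst norm_powr_real_powr) (use that in auto)
    also have "\<dots> \<le> (1 + x) powr \<bar>r\<bar>"
      using that complex_Re_le_cmod[of w] by (intro powr_mono) auto
    also have "\<dots> \<le> 2 powr \<bar>r\<bar>"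
      using that by (intro powr_mono2) auto
    finally show ?thesis .
  qed
  then show ?case by (intro exI[of _ "2 powr \<bar>r\<bar>"]) auto
next
  case (Suc K)
  obtain C where C: "C \<ge> 0" "\<And>w x. norm w \<le> r + 1 \<Longrightarrow> 0 \<le> x \<Longrightarrow> x \<le> 1 \<Longrightarrow> norm (binom_rem K w x) \<le> C * x ^ K"
    using Suc.IH[of "r + 1"] by blast
  have "norm (binom_rem (Suc K) w x) \<le> \<bar>r\<bar> * C * x ^ Suc K" if wx: "norm w \<le> r" "0 \<le> x" "x \<le> 1" for w x
  proof -
    have "norm (binom_rem (Suc K) w x - binom_rem (Suc K) w 0) \<le> (\<bar>r\<bar> * (C * x ^ K)) * norm (x - 0)"
    proof (rule differentiable_bound[where S = "{0..x}" and f' = "\<lambda>y h. h *\<^sub>R (w * binom_rem K (w - 1) y)"])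
      fix y assume y: "y \<in> {0..x}"
      show "(binom_rem (Suc K) w has_derivative (\<lambda>h. h *\<^sub>R (w * binom_rem K (w - 1) y))) (at y within {0..x})"
        using binom_rem_deriv[of y K w "{0..x}"] y by (simp add: has_vector_derivative_def)
      have "norm (w - 1) \<le> r + 1"
        using norm_triangle_ineq4[of w 1] wx by simp
      then have "norm (binom_rem K (w - 1) y) \<le> C * y ^ K"
        using C(2) y wx by auto
      also have "\<dots> \<le> C * x ^ K"
        using y C(1) by (intro mult_left_mono power_mono) auto
      finally have "norm (w * binom_rem K (w - 1) y) \<le> \<bar>r\<bar> * (C * x ^ K)"
        unfolding norm_mult using wx by (intro mult_mono) auto
      then show "onorm (\<lambda>h. h *\<^sub>R (w * binom_rem K (w - 1) y)) \<le> \<bar>r\<bar> * (C * x ^ K)"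
        by (intro onorm_le) (simp add: mult_left_mono mult.commute)
    qed (use wx in auto)
    moreover have "binom_rem (Suc K) w 0 = 0"
      by (simp add: binom_rem_def sum.lessThan_Suc_shift)
    ultimately show ?thesis using wx by (simp add: mult_ac)
  qed
  then show ?case using C(1) by (intro exI[of _ "\<bar>r\<bar> * C"]) auto
qed

definition zeta_term :: "nat \<Rightarrow> nat \<Rightarrow> complex \<Rightarrow> complex" where
  "zeta_term K n s = of_nat (Suc n) powr (1 - s) - of_nat (Suc (Suc n)) powr (1 - s)
     + (\<Sum>k=1..K. (1 - s gchoose k) * of_nat (Suc n) powr (1 - s - of_nat k))"

lemma zeta_term_binom_rem:
  "zeta_term K n s = - (of_nat (Suc n) powr (1 - s) * binom_rem (Suc K) (1 - s) (1 / real (Suc n)))"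
proof -
  let ?N = "complex_of_real (real (Suc n))"
  have N: "?N \<noteq> 0" by (simp del: of_nat_Suc)
  have 1: "of_nat (Suc (Suc n)) powr (1 - s) = ?N powr (1 - s) * (1 + of_real (1 / real (Suc n))) powr (1 - s)"
  proof -
    have "complex_of_nat (Suc (Suc n)) = ?N * (1 + of_real (1 / real (Suc n)))"
      using N by (simp add: distrib_left del: of_nat_Suc) simp
    also have "\<dots> = of_real (real (Suc n)) * of_real (1 + 1 / real (Suc n))" by simp
    also have "\<dots> powr (1 - s) = ?N powr (1 - s) * of_real (1 + 1 / real (Suc n)) powr (1 - s)"
      by (rule powr_times_real_left) auto
    finally show ?thesis by simp
  qed
  have 2: "of_nat (Suc n) powr (1 - s - of_nat k) = ?N powr (1 - s) * of_real (1 / real (Suc n)) ^ k" for k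
  proof -
    have "?N powr (1 - s - of_nat k) = ?N powr (1 - s) / ?N ^ k"
      using N by (subst powr_diff) (simp add: powr_nat' del: of_nat_Suc)
    then show ?thesis
      by (simp add: power_one_over divide_inverse power_inverse del: of_nat_Suc)
  qed
  have 3: "(\<Sum>k<Suc K. (1 - s gchoose k) * of_real (1 / real (Suc n)) ^ k) =
      1 + (\<Sum>k=1..K. (1 - s gchoose k) * complex_of_real (1 / real (Suc n)) ^ k)"
  proof -
    have "{..<Suc K} = insert 0 {1..K}" by auto
    then show ?thesis by simp
  qed
  show ?thesis
    unfolding zeta_term_def binom_rem_def 1 2 3
    by (simp add: algebra_simps sum_distrib_left del: of_nat_Suc)
qed

lemma zeta_term_bound:
  "\<exists>C\<ge>0. \<forall>s n. norm s \<le> r \<longrightarrow> norm (zeta_term K n s) \<le> C * real (Suc n) powr (- Re s - real K)"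
proof -
  obtain C where C: "C \<ge> 0" "\<And>w x. norm w \<le> r + 1 \<Longrightarrow> 0 \<le> x \<Longrightarrow> x \<le> 1 \<Longrightarrow>
      norm (binom_rem (Suc K) w x) \<le> C * x ^ Suc K"
    using binom_rem_bound[of "r + 1" "Suc K"] by blast
  have "norm (zeta_term K n s) \<le> C * real (Suc n) powr (- Re s - real K)" if s: "norm s \<le> r" for s n
  proof -
    let ?N = "real (Suc n)"
    have N: "?N > 0" by simp
    have "norm (1 - s) \<le> r + 1" using norm_triangle_ineq4[of 1 s] s by simp
    then have "norm (binom_rem (Suc K) (1 - s) (1 / ?N)) \<le> C * (1 / ?N) ^ Suc K"
      by (intro C(2)) auto
    moreover have "norm (of_nat (Suc n) powr (1 - s)) = ?N powr (1 - Re s)"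
      using norm_powr_real_powr[of "of_real ?N" "1 - s"] by (simp del: of_nat_Suc)
    ultimately have "norm (zeta_term K n s) \<le> ?N powr (1 - Re s) * (C * (1 / ?N) ^ Suc K)"
      unfolding zeta_term_binom_rem norm_minus_cancel norm_mult
      by (intro mult_mono) auto
    also have "(1 / ?N) ^ Suc K = ?N powr (- real (Suc K))"
      using N powr_realpow[OF N, of "Suc K"]
      by (simp add: power_one_over powr_minus field_simps del: of_nat_Suc power_Suc)
    also have "?N powr (1 - Re s) * (C * ?N powr (- real (Suc K))) = C * ?N powr (- Re s - real K)"
    proof -
      have "?N powr (1 - Re s) * ?N powr (- real (Suc K)) = ?N powr (- Re s - real K)"
        unfolding powr_add[symmetric] by (simp add: algebra_simps)
      then show ?thesis by (metis mult.left_commute)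
    qed
    finally show ?thesis .
  qed
  then show ?thesis using C(1) by blast
qed

lemma summable_Suc_powr:
  assumes "a < -1"
  shows "summable (\<lambda>n. real (Suc n) powr a)"
  using assms summable_real_powr_iff[of a] by (subst summable_Suc_iff) auto

lemma open_Re_greater: "open {s. a < Re s}"
  by (rule open_halfspace_Re_gt)

lemma holomorphic_series_Re:
  fixes f :: "nat \<Rightarrow> complex \<Rightarrow> complex"
  assumes hol: "\<And>n. f n holomorphic_on {s. b < Re s}"
    and bd: "\<And>r. \<exists>C\<ge>0. \<forall>s n. norm s \<le> r \<longrightarrow> norm (f n s) \<le> C * real (Suc n) powr (b - 1 - Re s)"
  shows "(\<lambda>s. \<Sum>n. f n s) holomorphic_on {s. b < Re s}"
proof (rule holomorphic_suminf_local_bound[OF open_Re_greater hol])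
  fix x assume x: "x \<in> {s. b < Re s}"
  define d where "d = (Re x - b) / 2"
  have d: "d > 0" using x by (simp add: d_def)
  obtain C where C: "C \<ge> 0" "\<And>s n. norm s \<le> norm x + d \<Longrightarrow> norm (f n s) \<le> C * real (Suc n) powr (b - 1 - Re s)"
    using bd[of "norm x + d"] by blast
  have y: "norm y \<le> norm x + d" "Re y \<ge> b + d" if "y \<in> cball x d" for y
  proof -
    have *: "norm (x - y) \<le> d" using that by (simp add: dist_norm)
    show "norm y \<le> norm x + d" using norm_triangle_ineq3[of x y] * by linarith
    have "Re x - Re y \<le> d" using complex_Re_le_cmod[of "x - y"] * by simp
    then show "Re y \<ge> b + d" by (simp add: d_def field_simps)
  qed
  have "norm (f n y) \<le> C * real (Suc n) powr (-1 - d)" if "y \<in> cball x d" for n y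
  proof -
    have "norm (f n y) \<le> C * real (Suc n) powr (b - 1 - Re y)"
      using y[OF that] by (intro C(2))
    also have "\<dots> \<le> C * real (Suc n) powr (-1 - d)"
      using y[OF that] C(1) by (intro mult_left_mono powr_mono) auto
    finally show ?thesis .
  qed
  moreover have "summable (\<lambda>n. C * real (Suc n) powr (-1 - d))"
    using d by (intro summable_mult summable_Suc_powr) auto
  moreover have "cball x d \<subseteq> {s. b < Re s}"
    using y d by fastforce
  ultimately show "\<exists>d M. 0 < d \<and> cball x d \<subseteq> {s. b < Re s} \<and> summable M \<and>
      (\<forall>n. \<forall>y\<in>cball x d. norm (f n y) \<le> M n)"
    using d by (intro exI[of _ d] exI[of _ "\<lambda>n. C * real (Suc n) powr (-1 - d)"]) auto
qed

lemma norm_Suc_powr: "norm (complex_of_nat (Suc n) powr s) = real (Suc n) powr Re s"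
  using norm_powr_real_powr[of "of_real (real (Suc n))" s] by (simp del: of_nat_Suc)

lemma summable_zeta_series:
  assumes "Re s > 1"
  shows "summable (\<lambda>n. complex_of_nat (Suc n) powr (- s))"
  by (rule summable_norm_cancel)
     (use assms in \<open>simp add: norm_Suc_powr summable_Suc_powr del: of_nat_Suc\<close>)

lemma zeta_series_holomorphic:
  "(\<lambda>s. \<Sum>n. complex_of_nat (Suc n) powr (- s)) holomorphic_on {s. 1 < Re s}"
proof (rule holomorphic_series_Re)
  show "(\<lambda>s. complex_of_nat (Suc n) powr (- s)) holomorphic_on {s. 1 < Re s}" for n
    by (intro holomorphic_on_powr_right holomorphic_on_minus holomorphic_on_ident)
  show "\<exists>C\<ge>0. \<forall>s n. norm s \<le> r \<longrightarrow> norm (complex_of_nat (Suc n) powr (- s)) \<le> C * real (Suc n) powr (1 - 1 - Re s)" for r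
    by (rule exI[of _ 1]) (simp add: norm_Suc_powr del: of_nat_Suc)
qed

lemma zeta_term_series_holomorphic:
  "(\<lambda>s. \<Sum>n. zeta_term K n s) holomorphic_on {s. 1 - real K < Re s}"
proof (rule holomorphic_series_Re)
  have "(\<lambda>s. 1 - s gchoose k) holomorphic_on A" for k A
    unfolding gbinomial_prod_rev
    by (intro holomorphic_on_divide holomorphic_on_prod holomorphic_on_diff holomorphic_on_const holomorphic_on_ident) simp
  then show "zeta_term K n holomorphic_on {s. 1 - real K < Re s}" for n
    unfolding zeta_term_def[abs_def]
    by (intro holomorphic_on_add holomorphic_on_diff holomorphic_on_sum holomorphic_on_mult
        holomorphic_on_powr_right holomorphic_on_const holomorphic_on_ident) (simp_all del: of_nat_Suc)
  show "\<exists>C\<ge>0. \<forall>s n. norm s \<le> r \<longrightarrow> norm (zeta_term K n s) \<le> C * real (Suc n) powr (1 - real K - 1 - Re s)" for r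
  proof -
    have *: "1 - real K - 1 - Re s = - Re s - real K" for s by simp
    show ?thesis unfolding * by (rule zeta_term_bound)
  qed
qed

lemma zeta_term_sums:
  assumes s: "Re s > 1"
  shows "(\<lambda>n. zeta_term K n s) sums
    (1 + (\<Sum>k=1..K. (1 - s gchoose k) * (\<Sum>n. complex_of_nat (Suc n) powr (- (s + of_nat k - 1)))))"
proof -
  have "(\<lambda>n. complex_of_nat (Suc n) powr (1 - s)) \<longlonglongrightarrow> 0"
  proof (rule tendsto_norm_zero_cancel)
    have "filterlim (\<lambda>n. real (Suc n)) at_top sequentially"
      using filterlim_Suc filterlim_real_sequentially by (rule filterlim_compose[rotated])
    then have "(\<lambda>n. real (Suc n) powr (1 - Re s)) \<longlonglongrightarrow> 0"
      using s by (intro tendsto_neg_powr) auto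
    then show "(\<lambda>n. norm (complex_of_nat (Suc n) powr (1 - s))) \<longlonglongrightarrow> 0"
      by (simp add: norm_Suc_powr del: of_nat_Suc)
  qed
  from telescope_sums'[OF this]
  have "(\<lambda>n. of_nat (Suc n) powr (1 - s) - complex_of_nat (Suc (Suc n)) powr (1 - s)) sums 1"
    by simp
  moreover have "(\<lambda>n. complex_of_nat (Suc n) powr (1 - s - of_nat k)) sums
      (\<Sum>n. complex_of_nat (Suc n) powr (- (s + of_nat k - 1)))" if "k \<in> {1..K}" for k
  proof -
    have *: "1 - s - of_nat k = - (s + of_nat k - 1)" by simp
    show ?thesis unfolding *
      by (intro summable_sums summable_zeta_series) (use that s in auto)
  qed
  ultimately show ?thesis
    unfolding zeta_term_def by (intro sums_add sums_sum sums_mult) auto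
qed

lemma zeta_continuation_strip:
  "\<exists>g. g holomorphic_on {s. 1 - real m < Re s} \<and> (m \<ge> 1 \<longrightarrow> g 1 = 1) \<and>
     (\<forall>s. Re s > 1 \<longrightarrow> g s = (s - 1) * (\<Sum>n. complex_of_nat (Suc n) powr (- s)))"
proof (induction m)
  case 0
  have "(\<lambda>s. (s - 1) * (\<Sum>n. complex_of_nat (Suc n) powr (- s))) holomorphic_on {s. 1 < Re s}"
    by (intro holomorphic_intros zeta_series_holomorphic)
  then show ?case by (intro exI[of _ "\<lambda>s. (s - 1) * (\<Sum>n. complex_of_nat (Suc n) powr (- s))"]) simp
next
  case (Suc m)
  then obtain g where g: "g holomorphic_on {s. 1 - real m < Re s}"
    "\<And>s. Re s > 1 \<Longrightarrow> g s = (s - 1) * (\<Sum>n. complex_of_nat (Suc n) powr (- s))"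
    by blast
  define K where "K = Suc m"
  define c :: "nat \<Rightarrow> complex \<Rightarrow> complex" where "c = (\<lambda>k s. (\<Prod>j<k-1. 1 - s - of_nat j) / fact k)"
  define h where "h = (\<lambda>s. 1 - (\<Sum>n. zeta_term K n s) - (\<Sum>k=2..K. c k s * g (s + of_nat k - 1)))"
  have "(\<lambda>s. g (s + of_nat k - 1)) holomorphic_on {s. 1 - real K < Re s}" if "k \<in> {2..K}" for k
    using that by (intro holomorphic_on_compose_gen[OF _ g(1), unfolded o_def] holomorphic_intros)
      (auto simp: K_def)
  moreover have "c k holomorphic_on A" for k A
    unfolding c_def by (intro holomorphic_intros) auto
  ultimately have "h holomorphic_on {s. 1 - real K < Re s}"
    unfolding h_def by (intro holomorphic_intros zeta_term_series_holomorphic) auto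
  moreover have "h 1 = 1"
  proof -
    have "(0::complex) gchoose k = 0" if "k \<in> {1..K}" for k
      using that gbinomial_absorption'[of k "0::complex"] by simp
    then have "zeta_term K n 1 = 0" for n
      by (simp add: zeta_term_def del: of_nat_Suc)
    moreover have "c k 1 = 0" if "k \<in> {2..K}" for k
      using that by (auto simp: c_def intro!: bexI[of _ 0])
    ultimately show ?thesis by (simp add: h_def)
  qed
  moreover have "h s = (s - 1) * (\<Sum>n. complex_of_nat (Suc n) powr (- s))" if s: "Re s > 1" for s
  proof -
    define Z where "Z = (\<lambda>s. \<Sum>n. complex_of_nat (Suc n) powr (- s))"
    have "(1 - s gchoose k) * Z (s + of_nat k - 1) = - (c k s * g (s + of_nat k - 1))" if k: "k \<in> {2..K}" for k
    proof -
      obtain l where l: "k = Suc l" using k by (cases k) auto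
      have "(1 - s gchoose k) = c k s * (1 - s - of_nat l)"
        by (simp add: gbinomial_prod_rev c_def l atLeast0LessThan field_simps del: fact_Suc)
      also have "\<dots> = - (c k s * (s + of_nat k - 2))" by (simp add: l algebra_simps)
      finally have *: "(1 - s gchoose k) = - (c k s * (s + of_nat k - 2))" .
      have "g (s + of_nat k - 1) = (s + of_nat k - 1 - 1) * Z (s + of_nat k - 1)"
        unfolding Z_def using k s by (intro g(2)) auto
      also have "s + of_nat k - 1 - 1 = s + of_nat k - 2" by simp
      finally show ?thesis unfolding * by (simp only: mult_minus_left mult.assoc)
    qed
    then have "(\<Sum>k=2..K. (1 - s gchoose k) * Z (s + of_nat k - 1)) = - (\<Sum>k=2..K. c k s * g (s + of_nat k - 1))"
      by (simp add: sum_negf)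
    moreover have "{1..K} = insert 1 {2..K}" by (auto simp: K_def)
    moreover have "(\<Sum>n. zeta_term K n s) = 1 + (\<Sum>k=1..K. (1 - s gchoose k) * Z (s + of_nat k - 1))"
      using zeta_term_sums[OF s] unfolding Z_def by (rule sums_unique[symmetric])
    ultimately have "(\<Sum>n. zeta_term K n s) = 1 + (1 - s) * Z s - (\<Sum>k=2..K. c k s * g (s + of_nat k - 1))"
      by simp
    then show ?thesis unfolding h_def Z_def by (simp add: algebra_simps)
  qed
  ultimately show ?case unfolding K_def by blast
qed

lemma zeta_continuation_entire:
  "\<exists>g. g holomorphic_on UNIV \<and> g 1 = 1 \<and>
     (\<forall>s. Re s > 1 \<longrightarrow> g s = (s - 1) * (\<Sum>n. complex_of_nat (Suc n) powr (- s)))"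
proof -
  define H where "H = (\<lambda>m. {s. 1 - real m < Re s})"
  obtain g where g: "\<And>m. g m holomorphic_on H m" "\<And>m. m \<ge> 1 \<Longrightarrow> g m 1 = (1::complex)"
    "\<And>m s. Re s > 1 \<Longrightarrow> g m s = (s - 1) * (\<Sum>n. complex_of_nat (Suc n) powr (- s))"
    using zeta_continuation_strip unfolding H_def by metis
  have opn: "open (H m)" for m unfolding H_def by (rule open_Re_greater)
  have eq: "g m s = g m' s" if "m \<le> m'" "s \<in> H m" for m m' s
  proof (rule analytic_continuation_open[of "{s. 1 < Re s}" "H m" "g m" "g m'"])
    show "{s. 1 < Re s} \<noteq> {}" by (auto intro: exI[of _ 2])
    show "connected (H m)" unfolding H_def
      by (intro convex_connected convex_halfspace_Re_gt)
    show "g m' holomorphic_on H m"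
      using that by (intro holomorphic_on_subset[OF g(1)]) (auto simp: H_def)
  qed (use g that opn in \<open>auto simp: H_def open_Re_greater\<close>)
  define N where "N = (\<lambda>s. nat \<lceil>2 - Re s\<rceil>)"
  have N: "s \<in> H (N s)" for s unfolding H_def N_def by simp linarith
  define G where "G = (\<lambda>s. g (N s) s)"
  have G: "G s = g m s" if "s \<in> H m" for m s
    using eq[of "N s" m s] eq[of m "N s" s] N[of s] that
    unfolding G_def by (metis nle_le)
  have "G holomorphic_on H m" for m
    using g(1) by (rule holomorphic_transform) (simp add: G)
  then have "G holomorphic_on (\<Union>m\<in>UNIV. H m)"
    using opn by (intro holomorphic_on_UN_open)
  moreover have "(\<Union>m\<in>UNIV. H m) = UNIV" using N by blast
  moreover have "G 1 = 1" using G[of 1 1] g(2)[of 1] by (simp add: H_def)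
  moreover have "G s = (s - 1) * (\<Sum>n. complex_of_nat (Suc n) powr (- s))" if "Re s > 1" for s
    using G[of s 0] g(3)[of s 0] that by (simp add: H_def)
  ultimately show ?thesis by metis
qed

lemma is_zeta_continuation_exists: "\<exists>f. is_zeta_continuation f"
proof -
  obtain g where g: "g holomorphic_on UNIV"
    "\<And>s. Re s > 1 \<Longrightarrow> g s = (s - 1) * (\<Sum>n. complex_of_nat (Suc n) powr (- s))"
    using zeta_continuation_entire by blast
  have "(\<lambda>s. g s / (s - 1)) holomorphic_on - {1}"
    by (intro holomorphic_intros holomorphic_on_subset[OF g(1)]) auto
  moreover have "(\<lambda>k. complex_of_nat (Suc k) powr (- s)) sums (g s / (s - 1))" if "Re s > 1" for s
  proof -
    have "s \<noteq> 1" using that by auto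
    then show ?thesis
      using summable_sums[OF summable_zeta_series[OF that]] g(2)[OF that] by simp
  qed
  ultimately show ?thesis unfolding is_zeta_continuation_def by blast
qed

lemma is_zeta_continuation_unique:
  assumes "is_zeta_continuation f" "is_zeta_continuation f'" "z \<noteq> 1"
  shows "f z = f' z"
proof (rule analytic_continuation_open[of "{s. 1 < Re s}" "- {1}" f f'])
  show "{s. 1 < Re s} \<noteq> {}" by (auto intro: exI[of _ 2])
  show "connected (- {1::complex})"
    by (rule connected_punctured_universe) simp
qed (use assms in \<open>auto simp: is_zeta_continuation_def open_Re_greater intro: sums_unique2\<close>)

lemma is_zeta_continuation_riemann_zeta: "is_zeta_continuation riemann_zeta"
  unfolding riemann_zeta_def using is_zeta_continuation_exists by (rule someI_ex)

lemma riemann_zeta_holomorphic: "riemann_zeta holomorphic_on - {1}"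
  and riemann_zeta_sums: "Re z > 1 \<Longrightarrow> (\<lambda>k. of_nat (Suc k) powr (- z)) sums riemann_zeta z"
  using is_zeta_continuation_riemann_zeta by (auto simp: is_zeta_continuation_def)

lemma riemann_zeta_simple_pole: "is_pole riemann_zeta 1" "zorder riemann_zeta 1 = -1"
proof -
  obtain g where g: "g holomorphic_on UNIV" "g 1 = 1"
    "\<And>s. Re s > 1 \<Longrightarrow> g s = (s - 1) * (\<Sum>n. complex_of_nat (Suc n) powr (- s))"
    using zeta_continuation_entire by blast
  have eq: "(s - 1) * riemann_zeta s = g s" if "s \<noteq> 1" for s
  proof (rule analytic_continuation_open[of "{s. 1 < Re s}" "- {1}" "\<lambda>s. (s - 1) * riemann_zeta s"])
    show "{s. 1 < Re s} \<noteq> {}" by (auto intro: exI[of _ 2])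
    show "connected (- {1::complex})"
      by (rule connected_punctured_universe) simp
    show "(\<lambda>s. (s - 1) * riemann_zeta s) holomorphic_on - {1}"
      by (intro holomorphic_intros riemann_zeta_holomorphic)
    show "g holomorphic_on - {1}" using g(1) holomorphic_on_subset by blast
    show "(z - 1) * riemann_zeta z = g z" if "z \<in> {s. 1 < Re s}" for z
      using g(3)[of z] sums_unique[OF riemann_zeta_sums[of z]] that by simp
  qed (use that in \<open>auto simp: open_Re_greater\<close>)
  have eq': "riemann_zeta s = g s / (s - 1)" if "s \<noteq> 1" for s
    using eq[OF that] that by (simp add: field_simps)
  show "zorder riemann_zeta 1 = -1"
  proof (rule zorder_eqI[of UNIV 1 g])
    show "riemann_zeta w = g w * (w - 1) powi - 1" if "w \<in> UNIV" "w \<noteq> 1" for w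
      using eq'[OF that(2)] by (simp add: divide_inverse)
  qed (use g in auto)
  have "filterlim (\<lambda>s. g s / (s - 1)) at_infinity (at 1)"
  proof (rule filterlim_divide_at_infinity)
    have "isCont g 1"
      using holomorphic_on_imp_continuous_on[OF g(1)] by (simp add: continuous_on_eq_continuous_at)
    then show "(g \<longlongrightarrow> 1) (at 1)" using g(2) by (simp add: isCont_def)
    show "filterlim (\<lambda>s. s - 1) (at 0) (at (1::complex))"
      by (auto simp: filterlim_at eventually_at_filter intro!: tendsto_eq_intros)
  qed simp
  then show "is_pole riemann_zeta 1"
    unfolding is_pole_def
    by (rule filterlim_cong[THEN iffD1, rotated -1]) (auto simp: eventually_at_filter eq')
qed

subsection \<open>Absolute convergence of the integral defining \<^const>\<open>theta\<close>\<close>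

lemma finite_primes_le: "finite {p::nat. prime p \<and> real p \<le> t}"
proof (rule finite_subset)
  show "{p::nat. prime p \<and> real p \<le> t} \<subseteq> {..nat \<lfloor>t\<rfloor>}" by (auto simp: le_nat_floor)
qed simp

lemma mono_prime_pi: "mono prime_pi"
  unfolding prime_pi_def by (intro monoI card_mono finite_primes_le) auto

lemma prime_pi_le: "t \<ge> 0 \<Longrightarrow> real (prime_pi t) \<le> t"
proof -
  assume t: "t \<ge> 0"
  have "prime_pi t \<le> card {1..nat \<lfloor>t\<rfloor>}"
    unfolding prime_pi_def by (intro card_mono) (auto simp: le_nat_floor Suc_le_eq prime_gt_0_nat)
  with t show ?thesis by simp linarith
qed

lemma Li_integrable: "set_integrable lborel {2..t} (\<lambda>s::real. 1 / ln s)"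
  unfolding set_integrable_def
  by (rule borel_integrable_atLeastAtMost'[unfolded set_integrable_def])
     (auto intro!: continuous_intros)

lemma mono_Li: "mono Li"
proof (rule monoI)
  fix x y :: real assume "x \<le> y"
  then show "Li x \<le> Li y"
    unfolding Li_def set_lebesgue_integral_def
    by (intro integral_mono Li_integrable[unfolded set_integrable_def])
       (auto simp: indicator_def)
qed

lemma Li_bounds:
  assumes "t \<ge> 2"
  shows "0 \<le> Li t" "Li t \<le> 2 * t"
proof -
  have ln2: "ln (2::real) \<ge> 1 / 2" using ln2_ge_two_thirds by simp
  show "0 \<le> Li t"
    unfolding Li_def set_lebesgue_integral_def
    by (intro Bochner_Integration.integral_nonneg) (auto simp: indicator_def)
  have "Li t \<le> (LBINT s:{2..t}. 2)"
    unfolding Li_def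
  proof (rule set_integral_mono[OF Li_integrable])
    show "set_integrable lborel {2..t} (\<lambda>s::real. 2::real)"
      by (rule borel_integrable_atLeastAtMost') auto
    fix s assume "s \<in> {2..t}"
    then have "ln s \<ge> 1 / 2" using ln2 by (smt (verit) atLeastAtMost_iff ln_le_cancel_iff)
    then show "1 / ln s \<le> 2" by (simp add: field_simps)
  qed
  also have "\<dots> = 2 * (t - 2)"
    using assms by (simp add: set_lebesgue_integral_def)
  finally show "Li t \<le> 2 * t" by simp
qed

lemma theta_integrable:
  assumes "Re z > 1"
  shows "set_integrable lborel {2..} (\<lambda>t. complex_of_real (real (prime_pi t) - Li t) / of_real t powr (z + 1))"
proof (rule set_integrable_bound)
  have "((\<lambda>t. t powr (- Re z)) has_integral -(2 powr (- Re z + 1)) / (- Re z + 1)) {2..}"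
    using assms by (intro has_integral_powr_to_inf) auto
  then have "(\<lambda>t. t powr (- Re z)) absolutely_integrable_on {2..}"
    by (intro nonnegative_absolutely_integrable_1) (auto simp: integrable_on_def)
  then have "set_integrable lborel {2..} (\<lambda>t::real. t powr (- Re z))"
    unfolding set_integrable_def by (subst (asm) integrable_completion) auto
  then show "set_integrable lborel {2..} (\<lambda>t. 3 * t powr (- Re z))" by simp
  have [measurable]: "(\<lambda>t. real (prime_pi t)) \<in> borel_measurable borel" "Li \<in> borel_measurable borel"
    using mono_prime_pi mono_Li by (auto intro!: borel_measurable_mono simp: mono_def)
  show "set_borel_measurable lborel {2..} (\<lambda>t. complex_of_real (real (prime_pi t) - Li t) / of_real t powr (z + 1))"
    unfolding set_borel_measurable_def powr_def by measurable
  have "norm (complex_of_real (real (prime_pi t) - Li t) / of_real t powr (z + 1)) \<le> norm (3 * t powr (- Re z))"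
    if "t \<ge> 2" for t
  proof -
    have "\<bar>real (prime_pi t) - Li t\<bar> \<le> 3 * t"
      using prime_pi_le[of t] Li_bounds[of t] that by simp
    then have "norm (complex_of_real (real (prime_pi t) - Li t) / of_real t powr (z + 1)) \<le> 3 * t / t powr (Re z + 1)"
      using that by (simp add: norm_divide norm_powr_real_powr divide_right_mono flip: of_real_diff)
    also have "\<dots> = 3 * t powr (- Re z)"
      using that by (simp add: powr_add powr_minus field_simps)
    finally show ?thesis by simp
  qed
  then show "AE t in lborel. t \<in> {2..} \<longrightarrow> norm (complex_of_real (real (prime_pi t) - Li t) / of_real t powr (z + 1)) \<le> norm (3 * t powr (- Re z))"
    by simp
qed

end

theory Submission
  imports Defs
begin

text \<open>
The idea is to write zeta, up to its pole, as the exponential of a function in which \<open>\<theta>\<close> is the only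
summand that is not already known to be holomorphic for \<open>Re z > 1/2\<close>. All of the following is for
\<open>Re z > 1\<close> at first.

The Euler product gives \<open>\<zeta>(z) = exp (P(z) + K(z))\<close> with \<open>P(z) = \<Sum>\<^sub>p p powr (- z)\<close>, where \<open>K\<close> collects
the higher prime powers and converges, with holomorphic sum, for \<open>Re z > 1/2\<close>
(\<open>riemann_zeta_eq_exp\<close>, \<open>log_euler_holomorphic\<close>). Partial summation turns \<open>P\<close> into \<open>z\<close> times the
integral of \<open>prime_pi t * t powr (- z - 1)\<close>, and integration by parts turns the corresponding integral of
\<open>Li\<close> into \<open>L(z) = \<integral> t powr (- z) / ln t\<close> over \<open>t \<ge> 2\<close>. Hence \<open>z * \<theta>(z) = P(z) - L(z)\<close>
(\<open>theta_eq_transforms\<close>). Since \<open>L'(z) = - (2 powr (1 - z)) / (z - 1)\<close>, the function \<open>L\<close> behaves at 1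
like \<open>- ln (z - 1)\<close>, and \<open>(z - 1) * exp (L(z)) = c * exp (E(z))\<close> with \<open>E\<close> entire and \<open>c \<noteq> 0\<close>
(\<open>exp_Li_transform_continuation\<close>). Altogether

  \<open>(z - 1) * \<zeta>(z) = c * exp (z * \<theta>(z) + E(z) + K(z))\<close>.

If \<open>\<theta>\<close> is replaced by \<open>\<Theta>\<close>, the right-hand side is holomorphic and zero-free on \<open>G\<close>. Both sides agree
on the nonempty open set \<open>G \<inter> {z. Re z > 1}\<close>, hence on the connected set \<open>G - {1}\<close>, and so zeta has
no zero there. That \<open>\<theta>\<close> is holomorphic for \<open>Re z > 1\<close> is differentiation under the integral sign
(\<open>has_field_derivative_set_integral_powr\<close>).
\<close>

section \<open>Integrals of complex powers over a half-line\<close>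

lemma norm_of_real_powr: "t > 0 \<Longrightarrow> norm (complex_of_real t powr z) = t powr Re z"
  by (subst norm_powr_real_powr) auto

lemma norm_of_nat_powr: "n > 0 \<Longrightarrow> norm (complex_of_nat n powr z) = real n powr Re z"
  using norm_of_real_powr[of "real n" z] by simp

lemma set_integrable_powr_atLeast:
  fixes a e :: real
  assumes "a > 0" "e < -1"
  shows "set_integrable lborel {a..} (\<lambda>t. t powr e)"
    and "(LBINT t:{a..}. t powr e) = - (a powr (e + 1)) / (e + 1)"
proof -
  have hi: "((\<lambda>t. t powr e) has_integral - (a powr (e + 1)) / (e + 1)) {a..}"
    using assms by (intro has_integral_powr_to_inf) auto
  then have "(\<lambda>t. t powr e) absolutely_integrable_on {a..}"
    by (intro nonnegative_absolutely_integrable_1) (auto simp: integrable_on_def)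
  then show si: "set_integrable lborel {a..} (\<lambda>t. t powr e)"
    unfolding set_integrable_def by (subst (asm) integrable_completion) auto
  show "(LBINT t:{a..}. t powr e) = - (a powr (e + 1)) / (e + 1)"
    using set_borel_integral_eq_integral(2)[OF si] integral_unique[OF hi] by simp
qed

lemma set_integrable_times_powr:
  fixes f :: "real \<Rightarrow> complex"
  assumes [measurable]: "f \<in> borel_measurable borel"
    and "a > 0" and bd: "\<And>t. t \<ge> a \<Longrightarrow> norm (f t) \<le> C * t powr e" and "Re z > e + 1"
  shows "set_integrable lborel {a..} (\<lambda>t. f t * of_real t powr (- z))"
proof (rule set_integrable_bound)
  have "set_integrable lborel {a..} (\<lambda>t. t powr (e - Re z))"
    using assms by (intro set_integrable_powr_atLeast) auto
  then show "set_integrable lborel {a..} (\<lambda>t. C * t powr (e - Re z))" by simp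
  show "set_borel_measurable lborel {a..} (\<lambda>t. f t * of_real t powr (- z))"
    unfolding set_borel_measurable_def powr_def by measurable
  have "norm (f t * of_real t powr (- z)) \<le> norm (C * t powr (e - Re z))" if t: "t \<ge> a" for t
  proof -
    have "norm (f t * of_real t powr (- z)) \<le> (C * t powr e) * t powr (- Re z)"
      using bd[OF t] t assms(2) by (simp add: norm_mult norm_of_real_powr mult_right_mono)
    also have "\<dots> = C * t powr (e - Re z)"
      using t assms(2) by (simp add: powr_diff powr_minus field_simps)
    finally show ?thesis by (metis abs_ge_self order_trans real_norm_def)
  qed
  then show "AE t in lborel. t \<in> {a..} \<longrightarrow>
      norm (f t * of_real t powr (- z)) \<le> norm (C * t powr (e - Re z))"
    by simp
qed

lemma set_integral_FTC_atLeast: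
  fixes F f :: "real \<Rightarrow> complex"
  assumes si: "set_integrable lborel {a..} f"
    and d: "\<And>x. x \<ge> a \<Longrightarrow> (F has_vector_derivative f x) (at x within {a..})"
    and lim: "(F \<longlongrightarrow> L) at_top"
  shows "(LBINT t:{a..}. f t) = L - F a"
proof (rule tendsto_unique)
  show "((\<lambda>b. LBINT t:{a..b}. f t) \<longlongrightarrow> (LBINT t:{a..}. f t)) at_top"
    using si by (intro tendsto_set_lebesgue_integral_at_top) auto
  have "(LBINT t:{a..b}. f t) = F b - F a" if "b \<ge> a" for b
  proof -
    have "set_integrable lborel {a..b} f"
      by (rule set_integrable_subset[OF si]) auto
    then have "(LBINT t:{a..b}. f t) = integral {a..b} f"
      by (rule set_borel_integral_eq_integral)
    also have "\<dots> = F b - F a"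
      using that by (intro integral_unique fundamental_theorem_of_calculus)
        (auto intro: has_vector_derivative_within_subset[OF d])
    finally show ?thesis .
  qed
  moreover have "((\<lambda>b. F b - F a) \<longlongrightarrow> L - F a) at_top"
    by (intro tendsto_intros lim)
  ultimately show "((\<lambda>b. LBINT t:{a..b}. f t) \<longlongrightarrow> L - F a) at_top"
    by (rule_tac Lim_transform_eventually) (auto intro: eventually_at_top_linorderI[of a])
qed simp

lemma has_vector_derivative_of_real_powr:
  assumes "t > 0"
  shows "((\<lambda>t. complex_of_real t powr w) has_vector_derivative w * of_real t powr (w - 1)) (at t within A)"
proof -
  have "((\<lambda>x. x powr w) has_field_derivative w * of_real t powr (w - 1)) (at (complex_of_real t))"
    using assms by (auto intro!: derivative_eq_intros simp: complex_nonpos_Reals_iff)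
  from has_vector_derivative_real_field[OF this] show ?thesis .
qed

lemma tendsto_of_real_powr_at_top:
  assumes "Re w < 0"
  shows "((\<lambda>t. complex_of_real t powr w) \<longlongrightarrow> 0) at_top"
proof (rule Lim_null_comparison)
  show "\<forall>\<^sub>F t in at_top. norm (complex_of_real t powr w) \<le> t powr Re w"
    using eventually_gt_at_top[of 0] by eventually_elim (simp add: norm_of_real_powr)
  show "((\<lambda>t. t powr Re w) \<longlongrightarrow> 0) at_top"
    using assms by (intro tendsto_neg_powr filterlim_ident)
qed

lemma set_integral_of_real_powr_atLeast:
  assumes "a > 0" "Re z > 1"
  shows "set_integrable lborel {a..} (\<lambda>t. complex_of_real t powr (- z))"
    and "(LBINT t:{a..}. complex_of_real t powr (- z)) = of_real a powr (1 - z) / (z - 1)"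
proof -
  show si: "set_integrable lborel {a..} (\<lambda>t. complex_of_real t powr (- z))"
    using set_integrable_times_powr[of "\<lambda>_. 1" a 1 0 z] assms by simp
  have "(LBINT t:{a..}. complex_of_real t powr (- z)) = 0 - of_real a powr (1 - z) / (1 - z)"
  proof (rule set_integral_FTC_atLeast[OF si])
    fix x assume "x \<ge> a"
    have "((\<lambda>t. complex_of_real t powr (1 - z) / (1 - z)) has_vector_derivative
       (1 - z) * of_real x powr (1 - z - 1) / (1 - z)) (at x within {a..})"
      using \<open>x \<ge> a\<close> assms
      by (intro has_vector_derivative_divide has_vector_derivative_of_real_powr) auto
    moreover have "1 - z \<noteq> 0" using assms by auto
    ultimately show "((\<lambda>t. complex_of_real t powr (1 - z) / (1 - z)) has_vector_derivative
       of_real x powr (- z)) (at x within {a..})" by simp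
  next
    have "((\<lambda>t. complex_of_real t powr (1 - z) / (1 - z)) \<longlongrightarrow> 0 / (1 - z)) at_top"
      using assms by (intro tendsto_divide tendsto_of_real_powr_at_top tendsto_const) auto
    then show "((\<lambda>t. complex_of_real t powr (1 - z) / (1 - z)) \<longlongrightarrow> 0) at_top" by simp
  qed
  also have "\<dots> = of_real a powr (1 - z) / (z - 1)"
    by (metis diff_0 minus_diff_eq minus_divide_right)
  finally show "(LBINT t:{a..}. complex_of_real t powr (- z)) = of_real a powr (1 - z) / (z - 1)" .
qed

lemma has_field_derivative_of_real_powr_right:
  assumes "t > 0"
  shows "((\<lambda>w. complex_of_real t powr (- w)) has_field_derivative
           - (of_real (ln t) * of_real t powr (- w))) (at w within A)"
proof (rule has_field_derivative_at_within)
  show "((\<lambda>w. complex_of_real t powr (- w)) has_field_derivative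
           - (of_real (ln t) * of_real t powr (- w))) (at w)"
    using DERIV_chain'[OF DERIV_minus[OF DERIV_ident] has_field_derivative_powr_right[of "of_real t" "- w"]] assms
    by (simp add: Ln_of_real)
qed

text \<open>The mean value inequality on the disc of radius \<open>d\<close> around \<open>z\<close>. The point is
that the bound depends on \<open>h\<close> only through the factor \<open>norm h\<close>, so that after division
by \<open>h\<close> it dominates all small difference quotients at once.\<close>

lemma norm_powr_difference_quotient_le:
  assumes t: "t \<ge> 1" and h: "norm h \<le> d"
  shows "norm (complex_of_real t powr (- (z + h)) - of_real t powr (- z))
           \<le> ln t * t powr (d - Re z) * norm h"
proof -
  have "norm (complex_of_real t powr (- (z + h)) - of_real t powr (- z))
      \<le> ln t * t powr (d - Re z) * norm ((z + h) - z)"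
  proof (rule field_differentiable_bound[where S = "cball z d"
        and f' = "\<lambda>w. - (of_real (ln t) * of_real t powr (- w))"])
    fix w assume w: "w \<in> cball z d"
    show "((\<lambda>w. complex_of_real t powr (- w)) has_field_derivative
        - (of_real (ln t) * of_real t powr (- w))) (at w within cball z d)"
      using t by (intro has_field_derivative_of_real_powr_right) auto
    have "Re (z - w) \<le> d" using w complex_Re_le_cmod[of "z - w"] by (simp add: dist_norm)
    then have "t powr (- Re w) \<le> t powr (d - Re z)" using t by (intro powr_mono) auto
    then show "norm (- (of_real (ln t) * complex_of_real t powr (- w))) \<le> ln t * t powr (d - Re z)"
      using t by (simp add: norm_mult norm_of_real_powr mult_left_mono)
  qed (use h in \<open>auto simp: dist_norm intro: order_trans[OF norm_ge_zero]\<close>)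
  then show ?thesis by simp
qed

text \<open>Differentiation under the integral sign, by dominated convergence of the difference quotients.
The function \<open>f\<close> is merely measurable because it has to cover the step function
\<^const>\<open>prime_pi\<close>.\<close>

lemma has_field_derivative_set_integral_powr:
  fixes f :: "real \<Rightarrow> complex"
  assumes meas [measurable]: "f \<in> borel_measurable borel"
    and a: "a \<ge> 1" and bd: "\<And>t. t \<ge> a \<Longrightarrow> norm (f t) \<le> C" and z: "Re z > 1"
  shows "((\<lambda>z. LBINT t:{a..}. f t * of_real t powr (- z)) has_field_derivative
           - (LBINT t:{a..}. of_real (ln t) * f t * of_real t powr (- z))) (at z)"
proof -
  \<comment> \<open>One third of the room to the right of the line \<open>Re z = 1\<close> goes to the shift \<open>h\<close>, one third
    to the logarithm (\<open>ln t \<le> t powr d / d\<close>), and the last third keeps the majorant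
    \<open>t powr (2 * d - Re z)\<close> integrable.\<close>
  define d where "d = (Re z - 1) / 3"
  have d: "d > 0" using z by (simp add: d_def)
  have C: "C \<ge> 0" using bd[of a] by (metis norm_ge_zero order_trans order_refl)
  define F where "F = (\<lambda>z. LBINT t:{a..}. f t * of_real t powr (- z))"
  define q where "q = (\<lambda>h t. (of_real t powr (- (z + h)) - complex_of_real t powr (- z)) / h)"
  have si: "set_integrable lborel {a..} (\<lambda>t. f t * of_real t powr (- w))" if "Re w > 1" for w
    using bd a that C by (intro set_integrable_times_powr[of f a C 0]) auto
  have quot: "(F (z + h) - F z) / h = (LBINT t:{a..}. f t * q h t)" if h: "h \<in> ball 0 d" for h
  proof -
    have "Re (z + h) > 1"
      using abs_Re_le_cmod[of h] h d by (auto simp: d_def field_simps)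
    then have "F (z + h) - F z =
        (LBINT t:{a..}. f t * of_real t powr (- (z + h)) - f t * of_real t powr (- z))"
      unfolding F_def by (intro set_integral_diff(2)[symmetric] si z)
    moreover have "f t * q h t =
        (f t * of_real t powr (- (z + h)) - f t * of_real t powr (- z)) / h" for t
      by (simp add: q_def right_diff_distrib)
    ultimately show ?thesis by (simp only: set_integral_divide_zero)
  qed
  have lim: "((\<lambda>h. LBINT t:{a..}. f t * q h t) \<longlongrightarrow>
      (LBINT t:{a..}. - (of_real (ln t) * f t * of_real t powr (- z)))) (at 0 within ball 0 d)"
    unfolding tendsto_at_iff_sequentially o_def
  proof (intro allI impI)
    fix X :: "nat \<Rightarrow> complex"
    assume X: "\<forall>i. X i \<in> ball 0 d - {0}" "X \<longlonglongrightarrow> 0"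
    show "(\<lambda>i. LBINT t:{a..}. f t * q (X i) t) \<longlonglongrightarrow>
       (LBINT t:{a..}. - (of_real (ln t) * f t * of_real t powr (- z)))"
      unfolding set_lebesgue_integral_def
    proof (rule integral_dominated_convergence[where
          w = "\<lambda>t. indicator {a..} t *\<^sub>R (C / d * t powr (2 * d - Re z))"])
      show "(\<lambda>t. indicator {a..} t *\<^sub>R - (of_real (ln t) * f t * of_real t powr (- z)))
          \<in> borel_measurable lborel"
        unfolding powr_def by measurable
      show "(\<lambda>t. indicator {a..} t *\<^sub>R (f t * q (X i) t)) \<in> borel_measurable lborel" for i
        unfolding q_def powr_def by measurable
      have "set_integrable lborel {a..} (\<lambda>t. t powr (2 * d - Re z))"
        using a z by (intro set_integrable_powr_atLeast) (auto simp: d_def field_simps)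
      then have "set_integrable lborel {a..} (\<lambda>t. C / d * t powr (2 * d - Re z))" by (rule set_integrable_mult_right)
      then show "integrable lborel (\<lambda>t. indicator {a..} t *\<^sub>R (C / d * t powr (2 * d - Re z)))"
        unfolding set_integrable_def .
      have "(\<lambda>i. q (X i) t) \<longlonglongrightarrow> - (of_real (ln t) * of_real t powr (- z))" if "t \<ge> a" for t
      proof -
        have "((\<lambda>w. complex_of_real t powr (- w)) has_field_derivative
            - (of_real (ln t) * of_real t powr (- z))) (at z)"
          using a that by (intro has_field_derivative_of_real_powr_right) auto
        then have "((\<lambda>h. q h t) \<longlongrightarrow> - (of_real (ln t) * of_real t powr (- z))) (at 0)"
          unfolding DERIV_def q_def .
        then show ?thesis
          using X unfolding tendsto_at_iff_sequentially o_def by auto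
      qed
      from tendsto_mult[OF tendsto_const[of "f t" for t] this]
      show "AE t in lborel. (\<lambda>i. indicator {a..} t *\<^sub>R (f t * q (X i) t)) \<longlonglongrightarrow>
          indicator {a..} t *\<^sub>R - (of_real (ln t) * f t * of_real t powr (- z))"
        by (intro AE_I2) (auto simp: indicator_def mult_ac)
      have "norm (f t * q (X i) t) \<le> C / d * t powr (2 * d - Re z)" if t: "t \<ge> a" for i t
      proof -
        have Xi: "norm (X i) \<le> d" "X i \<noteq> 0" using X(1) by (auto simp: less_imp_le)
        then have "norm (q (X i) t) \<le> ln t * t powr (d - Re z)"
          unfolding q_def norm_divide using norm_powr_difference_quotient_le[of t "X i" d z] a t
          by (simp add: divide_le_eq)
        also have "\<dots> \<le> (t powr d / d) * t powr (d - Re z)"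
          using a t d by (intro mult_right_mono ln_powr_bound) auto
        also have "\<dots> = 1 / d * t powr (2 * d - Re z)"
          by (simp add: flip: powr_add)
        finally have "norm (f t) * norm (q (X i) t) \<le> C * (1 / d * t powr (2 * d - Re z))"
          using bd[OF t] C by (intro mult_mono) auto
        then show ?thesis by (simp add: norm_mult)
      qed
      then show "AE t in lborel. norm (indicator {a..} t *\<^sub>R (f t * q (X i) t))
          \<le> indicator {a..} t *\<^sub>R (C / d * t powr (2 * d - Re z))" for i
        by (intro AE_I2) (simp add: indicator_def)
    qed
  qed
  have "((\<lambda>h. (F (z + h) - F z) / h) \<longlongrightarrow>
      (LBINT t:{a..}. - (of_real (ln t) * f t * of_real t powr (- z)))) (at 0 within ball 0 d)"
    by (rule Lim_transform_eventually[OF lim])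
       (auto simp: eventually_at_filter quot intro!: always_eventually)
  then show ?thesis
    using d unfolding DERIV_def F_def
    by (subst (asm) at_within_open) (auto simp: set_lebesgue_integral_def)
qed

section \<open>The transforms of the prime counting function and of the logarithmic integral\<close>

lemma Li_has_real_derivative:
  assumes "t \<ge> 2"
  shows "(Li has_real_derivative 1 / ln t) (at t within {2..})"
proof -
  have eq: "Li = (\<lambda>t. integral {2..t} (\<lambda>s. 1 / ln s))"
    unfolding Li_def by (intro ext set_borel_integral_eq_integral(2) Li_integrable)
  have "(Li has_vector_derivative 1 / ln t) (at t within {2..t + 1})"
    unfolding eq using assms
    by (intro integral_has_vector_derivative) (auto intro!: continuous_intros)
  moreover have "at t within {2..t + 1} = at t within {2..}"
    by (rule at_within_nhd[of _ "{..<t + 1}"]) auto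
  ultimately show ?thesis by (simp add: has_real_derivative_iff_has_vector_derivative)
qed

lemma borel_measurable_Li [measurable]: "Li \<in> borel_measurable borel"
  and borel_measurable_prime_pi [measurable]: "(\<lambda>t. real (prime_pi t)) \<in> borel_measurable borel"
  using mono_Li mono_prime_pi by (auto intro!: borel_measurable_mono simp: mono_def)

text \<open>\<open>z\<close> times the Mellin-type integral of \<^const>\<open>Li\<close>, in the form that it takes after integration
by parts.\<close>

definition Li_transform :: "complex \<Rightarrow> complex" where
  "Li_transform z = (LBINT t:{2..}. of_real (1 / ln t) * of_real t powr (- z))"

lemma ln_inverse_bound: "t \<ge> 2 \<Longrightarrow> norm (complex_of_real (1 / ln t)) \<le> 2"
proof -
  assume t: "t \<ge> 2"
  have "ln 2 \<le> ln t" using t by simp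
  then have "ln t \<ge> 1 / 2" using ln2_ge_two_thirds by linarith
  then show ?thesis by (simp add: norm_divide field_simps)
qed

text \<open>The boundary terms vanish: at 2 because \<open>Li 2 = 0\<close>, and at infinity because
\<open>Li t\<close> is at most \<open>2 * t\<close> while \<open>Re z > 1\<close>.\<close>

lemma Li_transform_integration_by_parts:
  assumes z: "Re z > 1"
  shows "set_integrable lborel {2..} (\<lambda>t. of_real (Li t) * of_real t powr (- (z + 1)))"
    and "z * (LBINT t:{2..}. of_real (Li t) * of_real t powr (- (z + 1))) = Li_transform z"
proof -
  show si1: "set_integrable lborel {2..} (\<lambda>t. of_real (Li t) * of_real t powr (- (z + 1)))"
    using z Li_bounds by (intro set_integrable_times_powr[where C = 2 and e = 1]) auto
  have si2: "set_integrable lborel {2..} (\<lambda>t. of_real (1 / ln t) * of_real t powr (- z))"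
    using z ln_inverse_bound by (intro set_integrable_times_powr[where C = 2 and e = 0]) auto
  have si3: "set_integrable lborel {2..} (\<lambda>t. z * (of_real (Li t) * of_real t powr (- (z + 1))))"
    using si1 by simp
  have "(LBINT t:{2..}. of_real (1 / ln t) * of_real t powr (- z)
          - z * (of_real (Li t) * of_real t powr (- (z + 1)))) = 0 - of_real (Li 2) * of_real 2 powr (- z)"
  proof (rule set_integral_FTC_atLeast)
    show "set_integrable lborel {2..} (\<lambda>t. of_real (1 / ln t) * of_real t powr (- z)
          - z * (of_real (Li t) * of_real t powr (- (z + 1))))"
      by (intro set_integral_diff si2 si3)
    fix x :: real assume x: "x \<ge> 2"
    have "((\<lambda>t. complex_of_real (Li t)) has_vector_derivative of_real (1 / ln x)) (at x within {2..})"
      by (intro has_vector_derivative_of_real Li_has_real_derivative x)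
    then have "((\<lambda>t. of_real (Li t) * complex_of_real t powr (- z)) has_vector_derivative
        of_real (Li x) * (- z * of_real x powr (- z - 1)) + of_real (1 / ln x) * of_real x powr (- z))
        (at x within {2..})"
      using x by (intro has_vector_derivative_mult has_vector_derivative_of_real_powr) auto
    moreover have "- (z + 1) = - z - 1" by simp
    ultimately show "((\<lambda>t. of_real (Li t) * complex_of_real t powr (- z)) has_vector_derivative
        of_real (1 / ln x) * of_real x powr (- z)
          - z * (of_real (Li x) * of_real x powr (- (z + 1)))) (at x within {2..})"
      by (simp only:) (simp add: mult_ac)
  next
    show "((\<lambda>t. of_real (Li t) * complex_of_real t powr (- z)) \<longlongrightarrow> 0) at_top"
    proof (rule Lim_null_comparison)
      show "\<forall>\<^sub>F t in at_top. norm (of_real (Li t) * complex_of_real t powr (- z)) \<le> 2 * t powr (1 - Re z)"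
        using eventually_ge_at_top[of 2]
      proof eventually_elim
        case (elim t)
        then have "norm (of_real (Li t) * complex_of_real t powr (- z)) \<le> (2 * t) * t powr (- Re z)"
          using Li_bounds[of t] by (simp add: norm_mult norm_of_real_powr mult_right_mono)
        also have "\<dots> = 2 * t powr (1 - Re z)"
          using elim by (simp add: powr_diff powr_minus field_simps)
        finally show ?case .
      qed
      have "((\<lambda>t. 2 * t powr (1 - Re z)) \<longlongrightarrow> 2 * 0) at_top"
        using z by (intro tendsto_intros tendsto_neg_powr filterlim_ident) auto
      then show "((\<lambda>t. 2 * t powr (1 - Re z)) \<longlongrightarrow> 0) at_top" by simp
    qed
  qed
  moreover have "Li 2 = 0"
    unfolding Li_def set_borel_integral_eq_integral(2)[OF Li_integrable] by simp
  ultimately show "z * (LBINT t:{2..}. of_real (Li t) * of_real t powr (- (z + 1))) = Li_transform z"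
    unfolding set_integral_diff(2)[OF si2 si3] Li_transform_def by simp
qed

text \<open>Differentiating in \<open>z\<close> produces a factor \<open>ln t\<close>, which cancels the density \<open>1 / ln t\<close> of
\<^const>\<open>Li\<close> and leaves an elementary integral. This is what makes the singularity of
\<^const>\<open>Li_transform\<close> at 1 explicit.\<close>

lemma Li_transform_has_field_derivative:
  assumes z: "Re z > 1"
  shows "(Li_transform has_field_derivative - (2 powr (1 - z) / (z - 1))) (at z)"
proof -
  have "((\<lambda>z. LBINT t:{2..}. of_real (1 / ln t) * of_real t powr (- z)) has_field_derivative
      - (LBINT t:{2..}. of_real (ln t) * of_real (1 / ln t) * of_real t powr (- z))) (at z)"
    using ln_inverse_bound z by (intro has_field_derivative_set_integral_powr) auto
  also have "(LBINT t:{2..}. of_real (ln t) * of_real (1 / ln t) * of_real t powr (- z)) =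
      (LBINT t:{2..}. complex_of_real t powr (- z))"
    by (intro set_lebesgue_integral_cong) auto
  also have "\<dots> = 2 powr (1 - z) / (z - 1)"
    using set_integral_of_real_powr_atLeast(2)[of 2 z] z by simp
  finally show ?thesis unfolding Li_transform_def[abs_def] .
qed

definition prime_zeta_term :: "complex \<Rightarrow> nat \<Rightarrow> complex" where
  "prime_zeta_term z n = (if prime n then of_nat n powr (- z) else 0)"

lemma norm_prime_zeta_term:
  "norm (prime_zeta_term z n) = (if prime n then real n powr (- Re z) else 0)"
  using norm_of_real_powr[of "real n" "- z"] by (auto simp: prime_zeta_term_def prime_gt_0_nat)

lemma summable_norm_prime_zeta_term:
  assumes "Re z > 1"
  shows "summable (\<lambda>n. norm (prime_zeta_term z n))"
proof (rule summable_comparison_test')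
  show "summable (\<lambda>n. real n powr (- Re z))"
    using assms by (simp add: summable_real_powr_iff)
  show "norm (norm (prime_zeta_term z n)) \<le> real n powr (- Re z)" for n
    by (simp add: norm_prime_zeta_term)
qed

text \<open>Each prime \<open>p\<close> contributes to \<open>prime_pi t\<close> the indicator of \<open>t \<ge> p\<close>, whose integral
against \<open>z * t powr (- z - 1)\<close> is \<open>p powr (- z)\<close>. Sum and integral may be exchanged because the
integrals of the norms are summable.\<close>

lemma prime_pi_transform:
  assumes z: "Re z > 1"
  shows "z * (LBINT t:{2..}. of_real (real (prime_pi t)) * of_real t powr (- (z + 1)))
           = (\<Sum>n. prime_zeta_term z n)"
proof -
  define f where "f = (\<lambda>n t. if prime n then
      indicator {real n..} t *\<^sub>R complex_of_real t powr (- (z + 1)) else 0)"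
  have z0: "z \<noteq> 0" using z by auto
  have pos: "real n > 0" if "prime n" for n using that by (simp add: prime_gt_0_nat)
  have int: "integrable lborel (f n)" for n
    using set_integral_of_real_powr_atLeast(1)[of "real n" "z + 1"] z pos
    by (cases "prime n") (auto simp: f_def set_integrable_def)
  have val: "integral\<^sup>L lborel (f n) = prime_zeta_term z n / z" for n
    using set_integral_of_real_powr_atLeast(2)[of "real n" "z + 1"] z pos
    by (cases "prime n") (auto simp: f_def set_lebesgue_integral_def prime_zeta_term_def)
  have norm_val: "(\<integral>t. norm (f n t) \<partial>lborel) = norm (prime_zeta_term z n) / Re z" for n
  proof (cases "prime n")
    case True
    have "(\<integral>t. norm (f n t) \<partial>lborel) = (LBINT t:{real n..}. t powr (- Re z - 1))"
      unfolding set_lebesgue_integral_def using pos[OF True] True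
      by (intro Bochner_Integration.integral_cong) (auto simp: f_def indicator_def norm_of_real_powr)
    also have "\<dots> = real n powr (- Re z) / Re z"
      using set_integrable_powr_atLeast(2)[of "real n" "- Re z - 1"] pos[OF True] z by simp
    finally show ?thesis using True by (simp add: norm_prime_zeta_term)
  qed (simp add: f_def prime_zeta_term_def)
  have fin: "finite {p. prime p \<and> real p \<le> t}" for t by (rule finite_primes_le)
  have zero: "f n t = 0" if "n \<notin> {p. prime p \<and> real p \<le> t}" for n t
    using that by (auto simp: f_def)
  have "(\<lambda>n. integral\<^sup>L lborel (f n)) sums (\<integral>t. (\<Sum>n. f n t) \<partial>lborel)"
  proof (rule sums_integral[OF int])
    show "AE t in lborel. summable (\<lambda>n. norm (f n t))"
    proof (rule AE_I2)
      fix t :: real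
      show "summable (\<lambda>n. norm (f n t))"
        by (rule summable_finite[OF fin[of t]]) (simp add: zero)
    qed
    show "summable (\<lambda>n. \<integral>t. norm (f n t) \<partial>lborel)"
      unfolding norm_val by (intro summable_divide summable_norm_prime_zeta_term z)
  qed
  moreover have "(\<Sum>n. f n t) = indicator {2..} t *\<^sub>R
      (of_real (real (prime_pi t)) * of_real t powr (- (z + 1)))" for t
  proof -
    have "(\<Sum>n. f n t) = (\<Sum>n | prime n \<and> real n \<le> t. f n t)"
      by (rule suminf_finite[OF fin]) (simp add: zero)
    also have "\<dots> = (\<Sum>n | prime n \<and> real n \<le> t. complex_of_real t powr (- (z + 1)))"
      by (intro sum.cong) (auto simp: f_def)
    also have "\<dots> = of_real (real (prime_pi t)) * of_real t powr (- (z + 1))"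
      by (simp add: prime_pi_def)
    also have "\<dots> = indicator {2..} t *\<^sub>R (of_real (real (prime_pi t)) * of_real t powr (- (z + 1)))"
    proof (cases "t \<ge> 2")
      case False
      have "\<not> (prime p \<and> real p \<le> t)" for p :: nat
        using False prime_ge_2_nat[of p] by auto
      then have "{p. prime p \<and> real p \<le> t} = {}" by blast
      then have "prime_pi t = 0" unfolding prime_pi_def by (simp only: card.empty)
      then show ?thesis by simp
    qed simp
    finally show ?thesis .
  qed
  ultimately have "(\<lambda>n. prime_zeta_term z n / z) sums
      (LBINT t:{2..}. of_real (real (prime_pi t)) * of_real t powr (- (z + 1)))"
    unfolding val set_lebesgue_integral_def by simp
  from sums_mult[OF this, of z] show ?thesis
    using z0 by (simp add: sums_iff)
qed

lemma theta_eq_transforms: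
  assumes z: "Re z > 1"
  shows "z * theta z = (\<Sum>n. prime_zeta_term z n) - Li_transform z"
proof -
  have "set_integrable lborel {2..} (\<lambda>t. of_real (real (prime_pi t)) * of_real t powr (- (z + 1)))"
  proof (rule set_integrable_times_powr[where C = 1 and e = 1])
    show "(\<lambda>t. complex_of_real (real (prime_pi t))) \<in> borel_measurable borel"
      by measurable
  qed (use z prime_pi_le in auto)
  from set_integral_diff(2)[OF this Li_transform_integration_by_parts(1)[OF z]]
  have "theta z = (LBINT t:{2..}. of_real (real (prime_pi t)) * of_real t powr (- (z + 1)))
      - (LBINT t:{2..}. of_real (Li t) * of_real t powr (- (z + 1)))"
    unfolding theta_def by (simp only: powr_minus divide_inverse left_diff_distrib of_real_diff)
  then show ?thesis
    using prime_pi_transform[OF z] Li_transform_integration_by_parts(2)[OF z]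
    by (simp add: right_diff_distrib)
qed

text \<open>Dividing \<open>prime_pi t - Li t\<close> by \<open>t\<close> gives a bounded function, so differentiation under the
integral sign applies.\<close>

lemma theta_holomorphic: "theta holomorphic_on {z. Re z > 1}"
proof -
  define f where "f = (\<lambda>t. complex_of_real (real (prime_pi t) - Li t) / of_real t)"
  have f: "f \<in> borel_measurable borel" unfolding f_def by measurable
  have "norm (f t) \<le> 3" if "t \<ge> 2" for t
    using prime_pi_le[of t] Li_bounds[of t] that
    by (simp add: f_def norm_divide divide_le_eq flip: of_real_diff)
  then have "((\<lambda>z. LBINT t:{2..}. f t * of_real t powr (- z)) has_field_derivative
           - (LBINT t:{2..}. of_real (ln t) * f t * of_real t powr (- z))) (at z)" if "Re z > 1" for z
    using that f by (intro has_field_derivative_set_integral_powr) auto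
  then have "(\<lambda>z. LBINT t:{2..}. f t * of_real t powr (- z)) holomorphic_on {z. Re z > 1}"
    by (subst holomorphic_on_open) (auto simp: open_Re_greater)
  moreover have "theta = (\<lambda>z. LBINT t:{2..}. f t * of_real t powr (- z))"
    unfolding theta_def
    by (intro ext set_lebesgue_integral_cong) (auto simp: f_def powr_add powr_minus field_simps)
  ultimately show ?thesis by simp
qed

section \<open>The Euler product\<close>

text \<open>What remains of the logarithm of the Euler factor at \<open>n\<close> after removing \<open>n powr (- z)\<close>: the
contribution \<open>\<Sum>k\<ge>2. n powr (- k * z) / k\<close> of the higher powers of a prime. Being quadratic in
\<open>n powr (- z)\<close>, these terms are summable as far as \<open>Re z > 1/2\<close>, which is where the half-plane of
the theorem comes from.\<close>

definition log_euler_term :: "complex \<Rightarrow> nat \<Rightarrow> complex" where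
  "log_euler_term z n = (if prime n then - ln (1 - of_nat n powr (- z)) - of_nat n powr (- z) else 0)"

lemma norm_of_nat_powr_le:
  assumes "n \<ge> 2" "Re z > 1/2"
  shows "norm (complex_of_nat n powr (- z)) \<le> 2 powr (- (1/2))"
proof -
  have "norm (complex_of_nat n powr (- z)) = real n powr (- Re z)"
    using assms by (simp add: norm_of_nat_powr)
  also have "\<dots> \<le> real n powr (- (1/2))" using assms by (intro powr_mono) auto
  also have "\<dots> \<le> 2 powr (- (1/2))" using assms by (intro powr_mono2') auto
  finally show ?thesis .
qed

lemma two_powr_lt_1: "(2::real) powr (- (1/2)) < 1"
  by (rule powr_less_one) auto

lemma norm_log_euler_term_le:
  assumes "Re z > 1/2"
  shows "norm (log_euler_term z n) \<le> 1 / (1 - 2 powr (- (1/2))) * real n powr (- 2 * Re z)"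
proof (cases "prime n")
  case True
  then have n: "n \<ge> 2" by (rule prime_ge_2_nat)
  define w where "w = - (complex_of_nat n powr (- z))"
  have w: "norm w \<le> 2 powr (- (1/2))" "norm w = real n powr (- Re z)"
    using norm_of_nat_powr_le[OF n assms] n by (simp_all add: w_def norm_of_nat_powr)
  have "norm (log_euler_term z n) = norm (ln (1 + w) - w)"
    using True by (simp add: log_euler_term_def w_def norm_minus_commute add.commute)
  also have "\<dots> \<le> (norm w)^2 / (1 - norm w)"
    using w(1) two_powr_lt_1 by (intro Ln_approx_linear) linarith
  also have "\<dots> \<le> (norm w)^2 / (1 - 2 powr (- (1/2)))"
    using w(1) two_powr_lt_1 by (intro divide_left_mono mult_pos_pos) auto
  also have "(norm w)^2 = real n powr (- 2 * Re z)"
    unfolding w(2) using n by (simp add: power2_eq_square flip: powr_add)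
  finally show ?thesis by simp
qed (use two_powr_lt_1 in \<open>simp add: log_euler_term_def\<close>)

lemma summable_log_euler_term:
  assumes "Re z > 1/2"
  shows "summable (log_euler_term z)"
proof (rule summable_norm_cancel, rule summable_comparison_test')
  show "summable (\<lambda>n. 1 / (1 - 2 powr (- (1/2))) * real n powr (- 2 * Re z))"
    using assms by (intro summable_mult) (simp add: summable_real_powr_iff)
  show "norm (norm (log_euler_term z n)) \<le> 1 / (1 - 2 powr (- (1/2))) * real n powr (- 2 * Re z)" for n
    using norm_log_euler_term_le[OF assms] by simp
qed

lemma log_euler_holomorphic:
  "(\<lambda>z. \<Sum>n. log_euler_term z n) holomorphic_on {z. Re z > 1/2}"
proof (rule holomorphic_suminf_local_bound[OF open_Re_greater])
  fix n
  show "(\<lambda>z. log_euler_term z n) holomorphic_on {z. Re z > 1/2}"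
  proof (cases "prime n")
    case True
    then have n: "n \<ge> 2" by (rule prime_ge_2_nat)
    have "1 - complex_of_nat n powr (- z) \<notin> \<real>\<^sub>\<le>\<^sub>0" if "Re z > 1/2" for z
    proof -
      have "Re (complex_of_nat n powr (- z)) < 1"
        using norm_of_nat_powr_le[OF n that] two_powr_lt_1
          complex_Re_le_cmod[of "complex_of_nat n powr (- z)"] by linarith
      then show ?thesis by (auto simp: complex_nonpos_Reals_iff)
    qed
    then show ?thesis
      using True unfolding log_euler_term_def
      by (auto intro!: holomorphic_intros)
  qed (simp add: log_euler_term_def)
next
  fix x :: complex assume x: "x \<in> {z. Re z > 1/2}"
  define d where "d = (Re x - 1/2) / 2"
  define M where "M = (\<lambda>n. 1 / (1 - 2 powr (- (1/2))) * real n powr (- 1 - 2 * d))"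
  have d: "d > 0" using x by (simp add: d_def)
  have Re_y: "Re y \<ge> 1/2 + d" if "y \<in> cball x d" for y
  proof -
    have "Re (x - y) \<le> d"
      using that complex_Re_le_cmod[of "x - y"] by (simp add: dist_norm)
    then show ?thesis by (simp add: d_def field_simps)
  qed
  have "norm (log_euler_term y n) \<le> M n" if y: "y \<in> cball x d" for n y
  proof (cases "n = 0")
    case False
    have "norm (log_euler_term y n) \<le> 1 / (1 - 2 powr (- (1/2))) * real n powr (- 2 * Re y)"
      using Re_y[OF y] d by (intro norm_log_euler_term_le) linarith
    also have "\<dots> \<le> M n"
      unfolding M_def using Re_y[OF y] two_powr_lt_1 False by (intro mult_left_mono powr_mono) auto
    finally show ?thesis .
  qed (simp add: log_euler_term_def M_def)
  moreover have "summable M"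
    unfolding M_def using d by (intro summable_mult) (simp add: summable_real_powr_iff)
  moreover have "cball x d \<subseteq> {z. Re z > 1/2}"
    using Re_y d by fastforce
  ultimately show "\<exists>d M. 0 < d \<and> cball x d \<subseteq> {z. Re z > 1/2} \<and> summable M \<and>
      (\<forall>n. \<forall>y\<in>cball x d. norm (log_euler_term y n) \<le> M n)"
    using d by blast
qed

definition sieved_nats :: "nat set \<Rightarrow> nat set" where
  "sieved_nats A = {n. n > 0 \<and> (\<forall>p\<in>A. \<not> p dvd n)}"

lemma of_nat_powr_summable_on:
  assumes "Re z > 1"
  shows "(\<lambda>n. complex_of_nat n powr (- z)) summable_on A"
proof -
  have "summable (\<lambda>n. norm (complex_of_nat n powr (- z)))"
  proof (rule summable_comparison_test')
    show "summable (\<lambda>n. real n powr (- Re z))"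
      using assms by (simp add: summable_real_powr_iff)
    show "norm (norm (complex_of_nat n powr (- z))) \<le> real n powr (- Re z)" for n
      by (cases "n = 0") (simp_all add: norm_of_nat_powr)
  qed
  then show ?thesis
    by (rule summable_on_subset_banach[OF norm_summable_imp_summable_on subset_UNIV])
qed

text \<open>The sieve of Eratosthenes: multiplication by \<open>1 - q powr (- z)\<close> removes from the sum exactly the
multiples of \<open>q\<close>, since a number \<open>q * m\<close> survives the sieve by the other primes iff
\<open>m\<close> does.\<close>

lemma finite_euler_product:
  assumes z: "Re z > 1" and A: "finite A" "\<And>p. p \<in> A \<Longrightarrow> prime p"
  shows "riemann_zeta z * (\<Prod>p\<in>A. 1 - of_nat p powr (- z)) =
           (\<Sum>\<^sub>\<infinity>n\<in>sieved_nats A. of_nat n powr (- z))"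
  using A
proof (induction A rule: finite_induct)
  case empty
  have "((\<lambda>n. complex_of_nat n powr (- z)) has_sum (\<Sum>\<^sub>\<infinity>n\<in>range Suc. of_nat n powr (- z))) (range Suc)"
    by (intro has_sum_infsum of_nat_powr_summable_on z)
  then have "((\<lambda>n. complex_of_nat (Suc n) powr (- z)) has_sum (\<Sum>\<^sub>\<infinity>n\<in>range Suc. of_nat n powr (- z))) UNIV"
    by (subst (asm) has_sum_reindex) (auto simp: o_def)
  then have "(\<lambda>n. complex_of_nat (Suc n) powr (- z)) sums (\<Sum>\<^sub>\<infinity>n\<in>range Suc. of_nat n powr (- z))"
    by (rule has_sum_imp_sums)
  then have "riemann_zeta z = (\<Sum>\<^sub>\<infinity>n\<in>range Suc. of_nat n powr (- z))"
    using riemann_zeta_sums[OF z] sums_unique2 by blast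
  moreover have "sieved_nats {} = range Suc"
    by (auto simp: sieved_nats_def image_iff intro: not0_implies_Suc)
  ultimately show ?case by simp
next
  case (insert q A)
  let ?f = "\<lambda>n. complex_of_nat n powr (- z)"
  have q: "prime q" and Ap: "\<And>p. p \<in> A \<Longrightarrow> prime p" using insert.prems by auto
  have q0: "q > 0" using q by (simp add: prime_gt_0_nat)
  have split: "sieved_nats A = sieved_nats (insert q A) \<union> (*) q ` sieved_nats A"
  proof (intro equalityI subsetI)
    fix n assume n: "n \<in> sieved_nats A"
    show "n \<in> sieved_nats (insert q A) \<union> (*) q ` sieved_nats A"
    proof (cases "q dvd n")
      case True
      then obtain m where m: "n = q * m" by blast
      with n have "m \<in> sieved_nats A" by (auto simp: sieved_nats_def)
      with m show ?thesis by blast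
    qed (use n in \<open>auto simp: sieved_nats_def\<close>)
  next
    fix n assume n: "n \<in> sieved_nats (insert q A) \<union> (*) q ` sieved_nats A"
    have "\<not> p dvd q * m" if "p \<in> A" "m \<in> sieved_nats A" for p m
    proof -
      have "\<not> p dvd q"
        using that q Ap[OF that(1)] insert.hyps(2) primes_dvd_imp_eq by blast
      then show ?thesis
        using that Ap[OF that(1)] by (auto simp: sieved_nats_def prime_dvd_mult_iff)
    qed
    then show "n \<in> sieved_nats A"
      using n q0 by (auto simp: sieved_nats_def)
  qed
  have disj: "sieved_nats (insert q A) \<inter> (*) q ` sieved_nats A = {}"
    by (auto simp: sieved_nats_def)
  have "(\<Sum>\<^sub>\<infinity>n\<in>(*) q ` sieved_nats A. ?f n) = (\<Sum>\<^sub>\<infinity>m\<in>sieved_nats A. ?f (q * m))"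
    using q0 by (subst infsum_reindex) (auto simp: inj_on_def o_def)
  also have "\<dots> = (\<Sum>\<^sub>\<infinity>m\<in>sieved_nats A. ?f q * ?f m)"
  proof (rule infsum_cong)
    fix m
    show "?f (q * m) = ?f q * ?f m"
      using powr_times_real_left[of "of_nat q" "of_nat m" "- z"] by simp
  qed
  also have "\<dots> = ?f q * (\<Sum>\<^sub>\<infinity>m\<in>sieved_nats A. ?f m)"
    by (rule infsum_cmult_right') 
  finally have mult: "(\<Sum>\<^sub>\<infinity>n\<in>(*) q ` sieved_nats A. ?f n) = ?f q * (\<Sum>\<^sub>\<infinity>m\<in>sieved_nats A. ?f m)" .
  have "(\<Sum>\<^sub>\<infinity>n\<in>sieved_nats A. ?f n) =
      (\<Sum>\<^sub>\<infinity>n\<in>sieved_nats (insert q A). ?f n) + ?f q * (\<Sum>\<^sub>\<infinity>m\<in>sieved_nats A. ?f m)"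
    by (subst split, subst infsum_Un_disjoint) (simp_all add: of_nat_powr_summable_on z disj mult)
  then have "(1 - ?f q) * (\<Sum>\<^sub>\<infinity>n\<in>sieved_nats A. ?f n) = (\<Sum>\<^sub>\<infinity>n\<in>sieved_nats (insert q A). ?f n)"
    by (simp add: algebra_simps)
  moreover have "riemann_zeta z * (\<Prod>p\<in>insert q A. 1 - ?f p) =
      (1 - ?f q) * (riemann_zeta z * (\<Prod>p\<in>A. 1 - ?f p))"
    using insert.hyps by simp
  ultimately show ?case
    using insert.IH[OF Ap] by simp
qed

text \<open>After sieving by all primes below \<open>N\<close>, the only survivor smaller than \<open>N\<close> is 1; the others
contribute at most a tail of a convergent series. The limit is stated as that of a product with zeta,
so that non-vanishing of zeta for \<open>Re z > 1\<close> is a consequence and not a prerequisite.\<close>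

lemma euler_product_tendsto:
  assumes z: "Re z > 1"
  shows "(\<lambda>N. riemann_zeta z * (\<Prod>p | prime p \<and> p < N. 1 - of_nat p powr (- z))) \<longlonglongrightarrow> 1"
proof -
  let ?f = "\<lambda>n. complex_of_nat n powr (- z)"
  define g where "g = (\<lambda>n. real n powr (- Re z))"
  have g: "summable g" unfolding g_def using z by (simp add: summable_real_powr_iff)
  have g_on: "g summable_on A" for A
    using summable_on_subset_banach[OF _ subset_UNIV] g
    by (metis g_def powr_ge_zero summable_on_UNIV_nonneg_real_iff)
  have tail: "norm (riemann_zeta z * (\<Prod>p | prime p \<and> p < N. 1 - ?f p) - 1) \<le> (\<Sum>n. g (n + N))"
    if N: "N \<ge> 2" for N
  proof -
    define S where "S = sieved_nats {p. prime p \<and> p < N}"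
    have fin: "finite {p. prime p \<and> p < N}" by simp
    have one: "1 \<in> S" by (auto simp: S_def sieved_nats_def)
    have sub: "S - {1} \<subseteq> {N..}"
    proof
      fix n assume n: "n \<in> S - {1}"
      then obtain p where p: "prime p" "p dvd n" using prime_factor_nat[of n] by auto
      with n have "p \<ge> N" by (auto simp: S_def sieved_nats_def)
      moreover have "p \<le> n" using p n by (intro dvd_imp_le) (auto simp: S_def sieved_nats_def)
      ultimately show "n \<in> {N..}" by simp
    qed
    have "riemann_zeta z * (\<Prod>p | prime p \<and> p < N. 1 - ?f p) = (\<Sum>\<^sub>\<infinity>n\<in>S. ?f n)"
      unfolding S_def by (intro finite_euler_product z fin) auto
    also have "S = {1} \<union> (S - {1})" using one by blast
    also have "(\<Sum>\<^sub>\<infinity>n\<in>{1} \<union> (S - {1}). ?f n) = 1 + (\<Sum>\<^sub>\<infinity>n\<in>S - {1}. ?f n)"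
      by (subst infsum_Un_disjoint) (auto intro: of_nat_powr_summable_on z)
    finally have "norm (riemann_zeta z * (\<Prod>p | prime p \<and> p < N. 1 - ?f p) - 1) = norm (\<Sum>\<^sub>\<infinity>n\<in>S - {1}. ?f n)"
      by simp
    also have "\<dots> \<le> (\<Sum>\<^sub>\<infinity>n\<in>S - {1}. g n)"
    proof (rule norm_infsum_le)
      show "(?f has_sum (\<Sum>\<^sub>\<infinity>n\<in>S - {1}. ?f n)) (S - {1})" "(g has_sum (\<Sum>\<^sub>\<infinity>n\<in>S - {1}. g n)) (S - {1})"
        by (intro has_sum_infsum of_nat_powr_summable_on z g_on)+
      show "norm (?f n) \<le> g n" if "n \<in> S - {1}" for n
        using that by (simp add: g_def norm_of_nat_powr S_def sieved_nats_def)
    qed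
    also have "\<dots> \<le> (\<Sum>\<^sub>\<infinity>n\<in>{N..}. g n)"
      using sub by (intro infsum_mono_neutral g_on) (auto simp: g_def)
    also have "{N..} = range (\<lambda>n. n + N)"
      by (auto simp: image_iff intro: le_add_diff_inverse2[symmetric])
    also have "infsum g (range (\<lambda>n. n + N)) = (\<Sum>\<^sub>\<infinity>n. g (n + N))"
      by (subst infsum_reindex) (auto simp: inj_on_def o_def)
    also have "\<dots> = (\<Sum>n. g (n + N))"
      using summable_ignore_initial_segment[OF g, of N]
      by (intro infsumI sums_nonneg_imp_has_sum summable_sums) (auto simp: g_def)
    finally show ?thesis .
  qed
  have "(\<lambda>N. \<Sum>n. g (n + N)) \<longlonglongrightarrow> 0"
    using g by (rule suminf_exist_split2)
  then have "(\<lambda>N. riemann_zeta z * (\<Prod>p | prime p \<and> p < N. 1 - ?f p) - 1) \<longlonglongrightarrow> 0"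
    by (rule Lim_null_comparison[rotated]) (use tail in \<open>auto intro: eventually_sequentiallyI[of 2]\<close>)
  then show ?thesis by (simp add: LIM_zero_iff)
qed

text \<open>The principal logarithms of the Euler factors may be added up without any correction by multiples of
\<open>2 * pi * \<i>\<close>, because the exponential of each partial sum is the finite product exactly.\<close>

lemma riemann_zeta_eq_exp:
  assumes z: "Re z > 1"
  shows "riemann_zeta z = exp ((\<Sum>n. prime_zeta_term z n) + (\<Sum>n. log_euler_term z n))"
proof -
  define a where "a = (\<lambda>n. prime_zeta_term z n + log_euler_term z n)"
  define s where "s = (\<Sum>n. prime_zeta_term z n) + (\<Sum>n. log_euler_term z n)"
  have "a sums s"
    unfolding a_def s_def using z
    by (intro sums_add summable_sums summable_log_euler_term
        summable_norm_cancel[OF summable_norm_prime_zeta_term]) auto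
  then have "(\<lambda>N. riemann_zeta z * exp (- (\<Sum>n<N. a n))) \<longlonglongrightarrow> riemann_zeta z * exp (- s)"
    unfolding sums_def by (intro tendsto_intros)
  moreover have "exp (- (\<Sum>n<N. a n)) = (\<Prod>p | prime p \<and> p < N. 1 - of_nat p powr (- z))" for N
  proof -
    have "exp (- (\<Sum>n<N. a n)) = (\<Prod>n<N. exp (- a n))"
      by (simp add: exp_sum flip: sum_negf)
    also have "\<dots> = (\<Prod>n<N. if prime n then 1 - of_nat n powr (- z) else 1)"
    proof (rule prod.cong)
      fix n :: nat
      show "exp (- a n) = (if prime n then 1 - of_nat n powr (- z) else 1)"
      proof (cases "prime n")
        case True
        then have "norm (complex_of_nat n powr (- z)) < 1"
          using norm_of_nat_powr_le[of n z] two_powr_lt_1 prime_ge_2_nat[of n] z by linarith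
        then have "1 - complex_of_nat n powr (- z) \<noteq> 0" by auto
        then show ?thesis
          using True by (simp add: a_def prime_zeta_term_def log_euler_term_def)
      qed (simp add: a_def prime_zeta_term_def log_euler_term_def)
    qed simp
    also have "\<dots> = (\<Prod>p | prime p \<and> p < N. 1 - of_nat p powr (- z))"
      by (subst prod.inter_filter[symmetric]) (auto intro: prod.cong)
    finally show ?thesis .
  qed
  ultimately have "riemann_zeta z * exp (- s) = 1"
    using LIMSEQ_unique[OF _ euler_product_tendsto[OF z]] by simp
  then have "riemann_zeta z = exp s"
    by (simp add: exp_minus field_simps)
  then show ?thesis unfolding s_def .
qed

section \<open>The logarithmic singularity at 1 and the continuation to \<open>G\<close>\<close>

text \<open>\<^const>\<open>Li_transform\<close> has a logarithmic singularity at 1, which the factor \<open>z - 1\<close> cancels. The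
logarithmic derivative of the left-hand side is \<open>(1 - 2 powr (1 - z)) / (z - 1)\<close>, whose singularity
at 1 is removable; so it has an entire primitive \<open>E\<close>, and only a nonzero constant factor is left.\<close>

lemma exp_Li_transform_continuation:
  obtains c E where "c \<noteq> 0" "E holomorphic_on UNIV"
    "\<And>z. Re z > 1 \<Longrightarrow> (z - 1) * exp (Li_transform z) = c * exp (E z)"
proof -
  define g where "g = (\<lambda>z::complex. 1 - 2 powr (1 - z))"
  \<comment> \<open>The term \<open>g 1 / (z - 1)\<close> is zero; it gives \<open>e\<close> the shape of the removable-singularity
    theorem.\<close>
  define e where "e = (\<lambda>z. if z = 1 then deriv g 1 else g z / (z - 1) - g 1 / (z - 1))"
  have "e holomorphic_on UNIV"
    unfolding e_def
  proof (rule pole_theorem)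
    show "g holomorphic_on UNIV" unfolding g_def by (intro holomorphic_intros) auto
  qed auto
  then obtain E where E: "\<And>z. (E has_field_derivative e z) (at z)"
    using holomorphic_convex_primitive'[OF convex_UNIV open_UNIV] by auto
  define h where "h = (\<lambda>z. (z - 1) * exp (Li_transform z - E z))"
  have "(h has_field_derivative 0) (at z within {z. Re z > 1})" if "z \<in> {z. Re z > 1}" for z
  proof (rule has_field_derivative_at_within)
    have z: "Re z > 1" and z1: "z \<noteq> 1" using that by auto
    have "(h has_field_derivative (z - 1) * (exp (Li_transform z - E z) * (- (2 powr (1 - z) / (z - 1)) - e z))
        + 1 * exp (Li_transform z - E z)) (at z)"
      unfolding h_def
      by (auto intro!: derivative_eq_intros Li_transform_has_field_derivative[OF z] E)
    also have "(z - 1) * (exp (Li_transform z - E z) * (- (2 powr (1 - z) / (z - 1)) - e z))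
        + 1 * exp (Li_transform z - E z) = 0"
      using z1 by (simp add: e_def g_def field_simps)
    finally show "(h has_field_derivative 0) (at z)" .
  qed
  then obtain c where c: "\<And>z. Re z > 1 \<Longrightarrow> h z = c"
    using has_field_derivative_zero_constant[OF convex_halfspace_Re_gt[of 1], of h] by auto
  show thesis
  proof (rule that)
    have "h 2 \<noteq> 0" by (simp add: h_def)
    then show "c \<noteq> 0" using c[of 2] by simp
    show "E holomorphic_on UNIV" using E by (auto simp: holomorphic_on_open)
    show "(z - 1) * exp (Li_transform z) = c * exp (E z)" if "Re z > 1" for z
      using c[OF that] by (simp add: h_def exp_diff field_simps)
  qed
qed

theorem mainTheorem1:
  fixes G :: "complex set" and \<Theta> :: "complex \<Rightarrow> complex"
  assumes "open G" and "connected G" and "G \<noteq> {}" and "simply_connected G"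
    and "G \<subseteq> {z. Re z > 1 / 2}"
    and "G \<inter> {z. Re z > 1} \<noteq> {}"
    and "\<Theta> holomorphic_on G"
    and "\<forall>z \<in> G \<inter> {z. Re z > 1}. \<Theta> z = theta z"
  shows "theta holomorphic_on {z. Re z > 1} \<and> (\<forall>z \<in> G - {1}. riemann_zeta z \<noteq> 0)"
proof (intro conjI ballI theta_holomorphic)
  obtain c E where c: "c \<noteq> 0" and E: "E holomorphic_on UNIV"
    and cE: "\<And>z. Re z > 1 \<Longrightarrow> (z - 1) * exp (Li_transform z) = c * exp (E z)"
    by (rule exp_Li_transform_continuation) blast
  \<comment> \<open>The zero-free function that continues \<open>(z - 1) * riemann_zeta z\<close>. Removing the point 1 from
    \<open>G\<close> keeps it connected, so the pole needs no special treatment.\<close>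
  define R where "R = (\<lambda>z. c * exp (z * \<Theta> z + E z + (\<Sum>n. log_euler_term z n)))"
  fix z assume z: "z \<in> G - {1}"
  have "(z - 1) * riemann_zeta z = R z"
  proof (rule analytic_continuation_open[of "G \<inter> {z. Re z > 1}" "G - {1}" _ R])
    show "open (G \<inter> {z. Re z > 1})" "open (G - {1})"
      using assms(1) by (auto simp: open_Re_greater)
    show "connected (G - {1})"
      using assms(1,2) by (intro connected_open_delete) auto
    show "(\<lambda>z. (z - 1) * riemann_zeta z) holomorphic_on G - {1}"
      by (intro holomorphic_intros holomorphic_on_subset[OF riemann_zeta_holomorphic]) auto
    show "R holomorphic_on G - {1}"
      unfolding R_def using assms(5)
      by (intro holomorphic_intros holomorphic_on_subset[OF assms(7)] holomorphic_on_subset[OF E]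
          holomorphic_on_subset[OF log_euler_holomorphic]) auto
    show "(w - 1) * riemann_zeta w = R w" if "w \<in> G \<inter> {z. Re z > 1}" for w
    proof -
      have w: "Re w > 1" and \<Theta>: "\<Theta> w = theta w" using that assms(8) by auto
      have "riemann_zeta w = exp (w * theta w + Li_transform w + (\<Sum>n. log_euler_term w n))"
        using riemann_zeta_eq_exp[OF w] theta_eq_transforms[OF w] by simp
      then show ?thesis
        using cE[OF w] by (simp add: R_def \<Theta> exp_add mult_ac)
    qed
  qed (use assms(6) z in auto)
  then show "riemann_zeta z \<noteq> 0"
    using c by (auto simp: R_def)
qed

end
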